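(* Let $d>1$ be an odd integer, let $X$ be the simplicial set (a triangulated torus, dual to $K_{3,3}$) described in the context, and let $\gamma:X_2\to\mathbb{Z}_d$ be a normalized $2$-cocycle. Then $\pi_1(\mathbb{Z}_d,X_\gamma)$ is abelian.
   Context: $X$ is the simplicial set with vertices $A,B,C$; nondegenerate edges (source$\to$target, where $d_1$ is the source and $d_0$ the target) $z_1,t_1,s_1:A\to B$; $x,y:B\to B$; $t_2,s_2,z_3:B\to C$; $z_2:A\to C$; and six nondegenerate $2$-simplices $\sigma_1,\dots,\sigma_6$ with faces $(d_2,d_0,d_1)$ given by $\sigma_1:(z_1,x,t_1)$, $\sigma_2:(t_1,t_2,z_2)$, $\sigma_3:(y,z_3,t_2)$, $\sigma_4:(z_1,y,s_1)$, $\sigma_5:(s_1,s_2,z_2)$, $\sigma_6:(x,z_3,s_2)$; all higher simplices are degenerate. Its realization is a torus, and the graph with vertices the triangles and edges the shared edges is $K_{3,3}$. A $2$-cocycle $\gamma$ is normalized if it vanishes on degenerate $2$-simplices. The twisted product $X_\gamma$ is the simplicial set with $n$-simplices $\mathbb{Z}_d^n\times X_n$, $d_i(\alpha,\tau)=(d_i\alpha,d_i\tau)$ for $1\le i\le n$, $s_j(\alpha,\tau)=(s_j\alpha,s_j\tau)$, $d_0(\alpha,\tau)=(\eta(\tau)+d_0\alpha,d_0\tau)$, with the nerve structure of $N\mathbb{Z}_d$ on $\alpha$ and $\eta(\tau)_1=\gamma(\tau|_{012})$, $\eta(\tau)_i=\gamma(\tau|_{0,i,i+1})-\gamma(\tau|_{1,i,i+1})$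 for $2\le i\le n-1$ ($\tau|_{ijk}$ the face of $\tau\in X_n$ on vertices $i,j,k$); so $d_0((a,b),\sigma)=(\gamma(\sigma)+b,d_0\sigma)$ for $\sigma\in X_2$. For a simplicial set $Y$, $\pi_1(\mathbb{Z}_d,Y)$ is the group generated by $e_u$, $u\in Y_1$, with relations $e_u^d=1$ for $u\in Y_1$, and $[e_{d_i\sigma},e_{d_j\sigma}]=1$, $e_{d_2\sigma}e_{d_0\sigma}=e_{d_1\sigma}$ for $\sigma\in Y_2$, $i,j\in\{0,1,2\}$. *)

theory Defs
  imports "HOL-Algebra.Elementary_Groups"
begin

section \<open>Simplicial sets\<close>

text \<open>The maps \<open>face Y n i\<close> and \<open>degen Y n j\<close> are \<open>d\<^sub>i\<close> and \<open>s\<^sub>j\<close> on the \<open>n\<close>-simplices;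
  they are only meaningful on \<open>simplices Y n\<close> and for \<open>i, j \<le> n\<close> (with \<open>n \<ge> 1\<close> for \<open>face\<close>).\<close>

record 'a sset =
  simplices :: "nat \<Rightarrow> 'a set"
  face :: "nat \<Rightarrow> nat \<Rightarrow> 'a \<Rightarrow> 'a"
  degen :: "nat \<Rightarrow> nat \<Rightarrow> 'a \<Rightarrow> 'a"

locale simplicial_set =
  fixes Y :: "'a sset" (structure)
  assumes face_closed:
      "\<lbrakk>x \<in> simplices Y n; 1 \<le> n; i \<le> n\<rbrakk> \<Longrightarrow> face Y n i x \<in> simplices Y (n - 1)"
    and degen_closed:
      "\<lbrakk>x \<in> simplices Y n; j \<le> n\<rbrakk> \<Longrightarrow> degen Y n j x \<in> simplices Y (n + 1)"
    and face_face:
      "\<lbrakk>x \<in> simplices Y n; 2 \<le> n; i < j; j \<le> n\<rbrakk>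
        \<Longrightarrow> face Y (n - 1) i (face Y n j x) = face Y (n - 1) (j - 1) (face Y n i x)"
    and degen_degen:
      "\<lbrakk>x \<in> simplices Y n; i \<le> j; j \<le> n\<rbrakk>
        \<Longrightarrow> degen Y (n + 1) i (degen Y n j x) = degen Y (n + 1) (j + 1) (degen Y n i x)"
    and face_degen_less:
      "\<lbrakk>x \<in> simplices Y n; i < j; j \<le> n\<rbrakk>
        \<Longrightarrow> face Y (n + 1) i (degen Y n j x) = degen Y (n - 1) (j - 1) (face Y n i x)"
    and face_degen_id:
      "\<lbrakk>x \<in> simplices Y n; j \<le> n; i = j \<or> i = j + 1\<rbrakk>
        \<Longrightarrow> face Y (n + 1) i (degen Y n j x) = x"
    and face_degen_greater:
      "\<lbrakk>x \<in> simplices Y n; j + 1 < i; i \<le> n + 1\<rbrakk>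
        \<Longrightarrow> face Y (n + 1) i (degen Y n j x) = degen Y (n - 1) j (face Y n (i - 1) x)"

definition degenerate :: "'a sset \<Rightarrow> nat \<Rightarrow> 'a set" where
  "degenerate Y n = {degen Y m j x | m j x. n = Suc m \<and> j \<le> m \<and> x \<in> simplices Y m}"

definition nondegenerate :: "'a sset \<Rightarrow> nat \<Rightarrow> 'a set" where
  "nondegenerate Y n = simplices Y n - degenerate Y n"

text \<open>\<open>restrict_to Y V n x\<close> is the face of the \<open>n\<close>-simplex \<open>x\<close> on the vertices in \<open>V\<close>.
  The vertices outside \<open>V\<close> are deleted from the highest one downwards, so that the ones still to
  be treated keep their numbers; in \<open>delete_outside Y V n k x\<close>, the \<open>n\<close>-simplex \<open>x\<close> still has to be
  treated at its vertices \<open>0, \<dots>, k - 1\<close>.\<close>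

fun delete_outside :: "'a sset \<Rightarrow> nat set \<Rightarrow> nat \<Rightarrow> nat \<Rightarrow> 'a \<Rightarrow> 'a" where
  "delete_outside Y V n 0 x = x"
| "delete_outside Y V n (Suc k) x =
     (if k \<in> V then delete_outside Y V n k x
      else delete_outside Y V (n - 1) k (face Y n k x))"

definition restrict_to :: "'a sset \<Rightarrow> nat set \<Rightarrow> nat \<Rightarrow> 'a \<Rightarrow> 'a" where
  "restrict_to Y V n x = delete_outside Y V n (n + 1) x"


section \<open>Twisted products\<close>

text \<open>An \<open>n\<close>-simplex of the nerve of a group is a list of \<open>n\<close> group elements.  Groups are written
  multiplicatively, also the additive group \<open>\<int>\<^sub>d = integer_mod_group d\<close>.\<close>

definition nerve :: "('g, 'm) monoid_scheme \<Rightarrow> 'g list sset" where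
  "nerve A = \<lparr>
     simplices = (\<lambda>n. {a. length a = n \<and> set a \<subseteq> carrier A}),
     face = (\<lambda>n i a. if i = 0 then tl a else if i = n then butlast a
               else take (i - 1) a @ [a ! (i - 1) \<otimes>\<^bsub>A\<^esub> a ! i] @ drop (i + 1) a),
     degen = (\<lambda>n j a. take j a @ [\<one>\<^bsub>A\<^esub>] @ drop j a)\<rparr>"

definition normalized_2_cocycle ::
    "('g, 'm) monoid_scheme \<Rightarrow> 'a sset \<Rightarrow> ('a \<Rightarrow> 'g) \<Rightarrow> bool" where
  "normalized_2_cocycle A X \<gamma> \<longleftrightarrow>
     \<gamma> \<in> simplices X 2 \<rightarrow> carrier A \<and>
     (\<forall>\<tau>\<in>simplices X 3.
        \<gamma> (face X 3 0 \<tau>) \<otimes>\<^bsub>A\<^esub> inv\<^bsub>A\<^esub> \<gamma> (face X 3 1 \<tau>)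
          \<otimes>\<^bsub>A\<^esub> \<gamma> (face X 3 2 \<tau>) \<otimes>\<^bsub>A\<^esub> inv\<^bsub>A\<^esub> \<gamma> (face X 3 3 \<tau>) = \<one>\<^bsub>A\<^esub>) \<and>
     (\<forall>\<sigma>\<in>degenerate X 2. \<gamma> \<sigma> = \<one>\<^bsub>A\<^esub>)"

definition twist ::
    "('g, 'm) monoid_scheme \<Rightarrow> 'a sset \<Rightarrow> ('a \<Rightarrow> 'g) \<Rightarrow> nat \<Rightarrow> 'a \<Rightarrow> 'g list" where
  "twist A X \<gamma> n \<tau> =
     map (\<lambda>i. if i = 1 then \<gamma> (restrict_to X {0, 1, 2} n \<tau>)
              else \<gamma> (restrict_to X {0, i, i + 1} n \<tau>)
                     \<otimes>\<^bsub>A\<^esub> inv\<^bsub>A\<^esub> \<gamma> (restrict_to X {1, i, i + 1} n \<tau>)) [1..<n]"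

definition twisted_product ::
    "('g, 'm) monoid_scheme \<Rightarrow> 'a sset \<Rightarrow> ('a \<Rightarrow> 'g) \<Rightarrow> ('g list \<times> 'a) sset" where
  "twisted_product A X \<gamma> = \<lparr>
     simplices = (\<lambda>n. simplices (nerve A) n \<times> simplices X n),
     face = (\<lambda>n i (\<alpha>, \<tau>).
       (if i = 0 then map2 (mult A) (twist A X \<gamma> n \<tau>) (face (nerve A) n 0 \<alpha>)
        else face (nerve A) n i \<alpha>, face X n i \<tau>)),
     degen = (\<lambda>n j (\<alpha>, \<tau>). (degen (nerve A) n j \<alpha>, degen X n j \<tau>))\<rparr>"

lemma twisted_product_face_2_0:
  "face (twisted_product A X \<gamma>) 2 0 ([a, b], \<sigma>) = ([\<gamma> \<sigma> \<otimes>\<^bsub>A\<^esub> b], face X 2 0 \<sigma>)"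
  by (simp add: twisted_product_def twist_def nerve_def restrict_to_def numeral_2_eq_2)


section \<open>Groups given by generators and relations\<close>

text \<open>A word is a list of letters \<open>(x, True)\<close>, standing for the generator \<open>x\<close>, and \<open>(x, False)\<close>,
  standing for its formal inverse.  A pair \<open>(l, r)\<close> of words in \<open>R\<close> is the relation \<open>l = r\<close>.\<close>

type_synonym 'x word = "('x \<times> bool) list"

inductive_set word_congruence :: "'x set \<Rightarrow> ('x word \<times> 'x word) set \<Rightarrow> ('x word \<times> 'x word) set"
  for S :: "'x set" and R :: "('x word \<times> 'x word) set" where
  refl: "w \<in> lists (S \<times> UNIV) \<Longrightarrow> (w, w) \<in> word_congruence S R"
| sym: "(v, w) \<in> word_congruence S R \<Longrightarrow> (w, v) \<in> word_congruence S R"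
| trans: "\<lbrakk>(u, v) \<in> word_congruence S R; (v, w) \<in> word_congruence S R\<rbrakk>
    \<Longrightarrow> (u, w) \<in> word_congruence S R"
| cancel: "\<lbrakk>u \<in> lists (S \<times> UNIV); v \<in> lists (S \<times> UNIV); x \<in> S\<rbrakk>
    \<Longrightarrow> (u @ [(x, b), (x, \<not> b)] @ v, u @ v) \<in> word_congruence S R"
| relation: "\<lbrakk>u \<in> lists (S \<times> UNIV); v \<in> lists (S \<times> UNIV);
      (l, r) \<in> R; l \<in> lists (S \<times> UNIV); r \<in> lists (S \<times> UNIV)\<rbrakk>
    \<Longrightarrow> (u @ l @ v, u @ r @ v) \<in> word_congruence S R"

definition presented_group :: "'x set \<Rightarrow> ('x word \<times> 'x word) set \<Rightarrow> 'x word set monoid" where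
  "presented_group S R = \<lparr>
     carrier = lists (S \<times> UNIV) // word_congruence S R,
     mult = (\<lambda>P Q. \<Union>v\<in>P. \<Union>w\<in>Q. word_congruence S R `` {v @ w}),
     one = word_congruence S R `` {[]}\<rparr>"

definition pi1_relations :: "nat \<Rightarrow> 'a sset \<Rightarrow> ('a word \<times> 'a word) set" where
  "pi1_relations d Y =
     {(replicate d (u, True), []) | u. u \<in> simplices Y 1} \<union>
     {([(face Y 2 i \<sigma>, True), (face Y 2 j \<sigma>, True), (face Y 2 i \<sigma>, False), (face Y 2 j \<sigma>, False)], [])
        | \<sigma> i j. \<sigma> \<in> simplices Y 2 \<and> i \<in> {0, 1, 2} \<and> j \<in> {0, 1, 2}} \<union>
     {([(face Y 2 2 \<sigma>, True), (face Y 2 0 \<sigma>, True)], [(face Y 2 1 \<sigma>, True)])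
        | \<sigma>. \<sigma> \<in> simplices Y 2}"

text \<open>The group \<open>\<pi>\<^sub>1(\<int>\<^sub>d, Y)\<close>.\<close>

definition pi1 :: "nat \<Rightarrow> 'a sset \<Rightarrow> 'a word set monoid" where
  "pi1 d Y = presented_group (simplices Y 1) (pi1_relations d Y)"


section \<open>The torus dual to the graph \<open>K\<^sub>3\<^sub>,\<^sub>3\<close>\<close>

datatype vertex = vA | vB | vC
datatype edge = ez1 | et1 | es1 | ex | ey | et2 | es2 | ez3 | ez2
datatype triangle = sigma1 | sigma2 | sigma3 | sigma4 | sigma5 | sigma6

fun source :: "edge \<Rightarrow> vertex" where
  "source ez1 = vA" | "source et1 = vA" | "source es1 = vA"
| "source ex = vB" | "source ey = vB"
| "source et2 = vB" | "source es2 = vB" | "source ez3 = vB"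
| "source ez2 = vA"

fun target :: "edge \<Rightarrow> vertex" where
  "target ez1 = vB" | "target et1 = vB" | "target es1 = vB"
| "target ex = vB" | "target ey = vB"
| "target et2 = vC" | "target es2 = vC" | "target ez3 = vC"
| "target ez2 = vC"

text \<open>The faces in the order \<open>(d\<^sub>2, d\<^sub>0, d\<^sub>1)\<close>.\<close>

fun boundary :: "triangle \<Rightarrow> edge \<times> edge \<times> edge" where
  "boundary sigma1 = (ez1, ex, et1)"
| "boundary sigma2 = (et1, et2, ez2)"
| "boundary sigma3 = (ey, ez3, et2)"
| "boundary sigma4 = (ez1, ey, es1)"
| "boundary sigma5 = (es1, es2, ez2)"
| "boundary sigma6 = (ex, ez3, es2)"

text \<open>A simplicial set is determined up to isomorphism by its nondegenerate simplices and their
  faces; here all faces of nondegenerate simplices are again nondegenerate.\<close>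

definition is_K33_torus ::
    "'a sset \<Rightarrow> (vertex \<Rightarrow> 'a) \<Rightarrow> (edge \<Rightarrow> 'a) \<Rightarrow> (triangle \<Rightarrow> 'a) \<Rightarrow> bool" where
  "is_K33_torus X v e t \<longleftrightarrow>
     simplicial_set X \<and>
     bij_betw v UNIV (nondegenerate X 0) \<and>
     bij_betw e UNIV (nondegenerate X 1) \<and>
     bij_betw t UNIV (nondegenerate X 2) \<and>
     (\<forall>n\<ge>3. nondegenerate X n = {}) \<and>
     (\<forall>a. face X 1 1 (e a) = v (source a) \<and> face X 1 0 (e a) = v (target a)) \<and>
     (\<forall>\<sigma>. (face X 2 2 (t \<sigma>), face X 2 0 (t \<sigma>), face X 2 1 (t \<sigma>)) =
            (case boundary \<sigma> of (a, b, c) \<Rightarrow> (e a, e b, e c)))"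

end

theory Submission
  imports Defs
begin

text \<open>
  Write \<open>J\<^sub>v(a)\<close> for the generator of the edge \<open>([a], s\<^sub>0 v)\<close>.  The triangles over the degenerate
  triangles \<open>s\<^sub>0 u\<close> and \<open>s\<^sub>1 u\<close>, on which \<open>\<gamma>\<close> vanishes, say that the generator of \<open>([a], u)\<close> is the
  generator of \<open>([0], u)\<close> times \<open>J(a)\<close>, taken at either end of \<open>u\<close>, and that the two factors commute.
  Hence \<open>J\<close> has the same value at both ends of \<open>u\<close> (\<open>fiber_source_eq_target\<close>).  As the torus is
  connected, there is one homomorphism \<open>J\<close>, with values in the centre and of exponent \<open>d\<close>, and the
  group is generated by \<open>J\<close> and the nine elements of the nondegenerate edges at \<open>0\<close>, subject to
  the relations of the six triangles with \<open>J(\<gamma>(\<sigma>))\<close> inserted (\<open>K33_triangle\<close>).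

  Four of the triangles write \<open>t\<^sub>1, t\<^sub>2, s\<^sub>1, s\<^sub>2\<close>, up to values of \<open>J\<close>, as the products
  \<open>p x, y q, p y, x q\<close> with \<open>p = z\<^sub>1\<close> and \<open>q = z\<^sub>3\<close>, and make \<open>p\<close> and \<open>q\<close> commute with \<open>x\<close> and \<open>y\<close>.  The
  other two both compute \<open>z\<^sub>2\<close>, so \<open>p x y q = p y x q c\<close> for some value \<open>c\<close> of \<open>J\<close>, which means
  \<open>x y = y x c\<close>.  They also say that \<open>p x\<close> commutes with \<open>y q\<close> and \<open>p y\<close> with \<open>x q\<close>, which means that
  the commutator of \<open>x\<close> and \<open>y\<close> agrees both with that of \<open>p\<close> and \<open>q\<close> and with its inverse.  So
  \<open>c\<^sup>2 = 1\<close>; together with \<open>c\<^sup>d = 1\<close> and \<open>d\<close> odd this gives \<open>c = 1\<close>, and then all generators commute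
  (\<open>K33_core\<close>).  This is the argument by which Mermin's square forces an involution, and an odd
  exponent leaves no room for one.
\<close>

section \<open>Groups given by generators and relations\<close>

definition word_class :: "'x set \<Rightarrow> ('x word \<times> 'x word) set \<Rightarrow> 'x word \<Rightarrow> 'x word set" where
  "word_class S R w = word_congruence S R `` {w}"

lemma word_congruence_words:
  assumes "(v, w) \<in> word_congruence S R"
  shows "v \<in> lists (S \<times> UNIV)" "w \<in> lists (S \<times> UNIV)"
  using assms by (induction rule: word_congruence.induct) auto

lemma equiv_word_congruence: "equiv (lists (S \<times> UNIV)) (word_congruence S R)"
proof (rule equivI)
  show "word_congruence S R \<subseteq> lists (S \<times> UNIV) \<times> lists (S \<times> UNIV)"
    using word_congruence_words by fast
  show "refl_on (lists (S \<times> UNIV)) (word_congruence S R)"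
    by (rule refl_onI) (rule word_congruence.refl)
  show "sym_on UNIV (word_congruence S R)"
    by (rule symI) (rule word_congruence.sym)
  show "trans_on UNIV (word_congruence S R)"
    by (rule transI) (rule word_congruence.trans)
qed

text \<open>Two-sided compatibility with concatenation is what makes multiplication of classes
  well defined.\<close>

lemma word_congruence_context:
  assumes "(v, w) \<in> word_congruence S R" "p \<in> lists (S \<times> UNIV)" "q \<in> lists (S \<times> UNIV)"
  shows "(p @ v @ q, p @ w @ q) \<in> word_congruence S R"
  using assms
proof (induction rule: word_congruence.induct)
  case (refl w)
  then show ?case by (intro word_congruence.refl) auto
next
  case (sym v w)
  then show ?case by (blast intro: word_congruence.sym)
next
  case (trans u v w)
  then show ?case by (blast intro: word_congruence.trans)
next
  case (cancel u v x b)
  then show ?case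
    using word_congruence.cancel[of "p @ u" S "v @ q" x b R] by simp
next
  case (relation u v l r)
  then show ?case
    using word_congruence.relation[of "p @ u" S "v @ q" l r R] by simp
qed

lemma word_class_eq_iff:
  assumes "v \<in> lists (S \<times> UNIV)" "w \<in> lists (S \<times> UNIV)"
  shows "word_class S R v = word_class S R w \<longleftrightarrow> (v, w) \<in> word_congruence S R"
  using eq_equiv_class_iff[OF equiv_word_congruence assms] by (simp add: word_class_def)

lemma word_class_closed:
  "w \<in> lists (S \<times> UNIV) \<Longrightarrow> word_class S R w \<in> carrier (presented_group S R)"
  by (simp add: presented_group_def word_class_def quotientI)

lemma presented_group_elem:
  assumes "P \<in> carrier (presented_group S R)"
  obtains w where "w \<in> lists (S \<times> UNIV)" "P = word_class S R w"
  using assms by (auto simp: presented_group_def word_class_def simp del: in_lists_conv_set elim!: quotientE)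

lemma word_class_append:
  assumes "v \<in> lists (S \<times> UNIV)" "w \<in> lists (S \<times> UNIV)"
  shows "word_class S R v \<otimes>\<^bsub>presented_group S R\<^esub> word_class S R w = word_class S R (v @ w)"
proof -
  let ?W = "lists (S \<times> (UNIV :: bool set))" and ?C = "word_congruence S R"
  have "congruent2 ?C ?C (\<lambda>v w. ?C `` {v @ w})"
  proof (rule congruent2I[OF equiv_word_congruence equiv_word_congruence])
    fix y z w assume "w \<in> ?W" "(y, z) \<in> ?C"
    then have "(y @ w, z @ w) \<in> ?C" "(w @ y, w @ z) \<in> ?C"
      using word_congruence_context[of y z S R "[]" w] word_congruence_context[of y z S R w "[]"]
      by auto
    then show "?C `` {y @ w} = ?C `` {z @ w}" "?C `` {w @ y} = ?C `` {w @ z}"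
      by (simp_all add: equiv_class_eq[OF equiv_word_congruence])
  qed
  from UN_equiv_class2[OF equiv_word_congruence equiv_word_congruence this assms]
  show ?thesis by (simp add: presented_group_def word_class_def)
qed

lemma one_presented_group: "\<one>\<^bsub>presented_group S R\<^esub> = word_class S R []"
  by (simp add: presented_group_def word_class_def)

lemma word_class_inverse_letters:
  assumes "x \<in> S"
  shows "word_class S R [(x, b)] \<otimes>\<^bsub>presented_group S R\<^esub> word_class S R [(x, \<not> b)] = \<one>\<^bsub>presented_group S R\<^esub>"
  using word_congruence.cancel[of "[]" S "[]" x b R] assms
  by (simp add: word_class_append one_presented_group word_class_eq_iff)

lemma group_presented_group: "group (presented_group S R)"
proof (rule groupI)
  fix P Q T
  assume "P \<in> carrier (presented_group S R)" "Q \<in> carrier (presented_group S R)"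
    "T \<in> carrier (presented_group S R)"
  then show "P \<otimes>\<^bsub>presented_group S R\<^esub> Q \<otimes>\<^bsub>presented_group S R\<^esub> T
      = P \<otimes>\<^bsub>presented_group S R\<^esub> (Q \<otimes>\<^bsub>presented_group S R\<^esub> T)"
    by (elim presented_group_elem) (simp add: word_class_append)
next
  fix P assume "P \<in> carrier (presented_group S R)"
  then obtain w where w: "w \<in> lists (S \<times> UNIV)" "P = word_class S R w"
    by (rule presented_group_elem)
  \<comment> \<open>The inverse word is built letter by letter: put the opposite of the first letter of \<open>w\<close>
     behind an inverse of the rest.\<close>
  have "\<exists>v\<in>lists (S \<times> UNIV). (v @ w, []) \<in> word_congruence S R"
    using w(1)
  proof (induction w)
    case Nil
    then show ?case by (auto intro: word_congruence.refl)
  next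
    case (Cons a w)
    obtain x b where a: "a = (x, b)" "x \<in> S" using Cons.hyps by auto
    obtain v where v: "v \<in> lists (S \<times> UNIV)" "(v @ w, []) \<in> word_congruence S R"
      using Cons.IH by blast
    have "(v @ [(x, \<not> b), (x, \<not> \<not> b)] @ w, v @ w) \<in> word_congruence S R"
      using v a Cons.hyps by (intro word_congruence.cancel) auto
    then have "((v @ [(x, \<not> b)]) @ a # w, []) \<in> word_congruence S R"
      using v(2) a(1) by (auto intro: word_congruence.trans)
    then show ?case using v(1) a(2) by (intro bexI[of _ "v @ [(x, \<not> b)]"]) auto
  qed
  then obtain v where v: "v \<in> lists (S \<times> UNIV)" "(v @ w, []) \<in> word_congruence S R" by blast
  then have "word_class S R v \<otimes>\<^bsub>presented_group S R\<^esub> P = \<one>\<^bsub>presented_group S R\<^esub>"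
    using w by (simp add: word_class_append one_presented_group word_class_eq_iff)
  then show "\<exists>Q\<in>carrier (presented_group S R). Q \<otimes>\<^bsub>presented_group S R\<^esub> P = \<one>\<^bsub>presented_group S R\<^esub>"
    using v(1) word_class_closed by blast
next
  fix P Q assume "P \<in> carrier (presented_group S R)" "Q \<in> carrier (presented_group S R)"
  then show "P \<otimes>\<^bsub>presented_group S R\<^esub> Q \<in> carrier (presented_group S R)"
    by (elim presented_group_elem) (simp add: word_class_append word_class_closed)
next
  fix P assume "P \<in> carrier (presented_group S R)"
  then show "\<one>\<^bsub>presented_group S R\<^esub> \<otimes>\<^bsub>presented_group S R\<^esub> P = P"
    by (elim presented_group_elem) (simp add: word_class_append one_presented_group)
qed (simp add: one_presented_group word_class_closed)

lemma presented_group_relation: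
  assumes "(l, r) \<in> R" "l \<in> lists (S \<times> UNIV)" "r \<in> lists (S \<times> UNIV)"
  shows "word_class S R l = word_class S R r"
  using word_congruence.relation[of "[]" S "[]" l r R] assms by (simp add: word_class_eq_iff)

lemma word_class_inverse_letter:
  assumes "x \<in> S"
  shows "word_class S R [(x, False)] = inv\<^bsub>presented_group S R\<^esub> word_class S R [(x, True)]"
  using word_class_inverse_letters[of x S R False] assms
  by (intro group.inv_equality[OF group_presented_group, symmetric]) (auto intro: word_class_closed)

lemma word_class_replicate:
  assumes "x \<in> S"
  shows "word_class S R (replicate n (x, True))
    = word_class S R [(x, True)] [^]\<^bsub>presented_group S R\<^esub> n"
proof (induction n)
  case 0
  then show ?case
    using group_presented_group[of S R]
    by (simp add: one_presented_group[symmetric] monoid.nat_pow_0 group.is_monoid)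
next
  case (Suc n)
  have "replicate (Suc n) (x, True) = replicate n (x, True) @ [(x, True)]"
    by (simp add: replicate_append_same)
  moreover have "replicate n (x, True) \<in> lists (S \<times> UNIV)"
    using assms by (auto simp: in_lists_conv_set)
  ultimately show ?case
    using Suc assms group_presented_group[of S R]
    by (simp add: word_class_append[symmetric] monoid.nat_pow_Suc group.is_monoid
        del: replicate_Suc)
qed

lemma (in group) commute_mult:
  assumes "w \<in> carrier G" "a \<in> carrier G" "b \<in> carrier G"
    and "w \<otimes> a = a \<otimes> w" "w \<otimes> b = b \<otimes> w"
  shows "w \<otimes> (a \<otimes> b) = (a \<otimes> b) \<otimes> w"
  using assms by (metis m_assoc)

lemma (in group) commute_inv:
  assumes "w \<in> carrier G" "a \<in> carrier G" "w \<otimes> a = a \<otimes> w"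
  shows "w \<otimes> inv a = inv a \<otimes> w"
  using assms by (metis inv_closed inv_solve_left inv_solve_right m_assoc m_closed)

text \<open>The centralizer of \<open>P\<close> is a subgroup, so it is everything once it contains the generators.\<close>

lemma commute_presented_group:
  fixes S :: "'x set" and R :: "('x word \<times> 'x word) set"
  defines "G \<equiv> presented_group S R"
  assumes "P \<in> carrier G"
    and gens: "\<And>x. x \<in> S \<Longrightarrow> P \<otimes>\<^bsub>G\<^esub> word_class S R [(x, True)] = word_class S R [(x, True)] \<otimes>\<^bsub>G\<^esub> P"
    and "Q \<in> carrier G"
  shows "P \<otimes>\<^bsub>G\<^esub> Q = Q \<otimes>\<^bsub>G\<^esub> P"
proof -
  interpret group G unfolding G_def by (rule group_presented_group)
  obtain w where w: "w \<in> lists (S \<times> UNIV)" "Q = word_class S R w"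
    using \<open>Q \<in> carrier G\<close> unfolding G_def by (rule presented_group_elem)
  have "P \<otimes>\<^bsub>G\<^esub> word_class S R w = word_class S R w \<otimes>\<^bsub>G\<^esub> P"
    using w(1)
  proof (induction w)
    case Nil
    then show ?case
      using \<open>P \<in> carrier G\<close> by (simp add: one_presented_group[symmetric] G_def[symmetric])
  next
    case (Cons a w)
    obtain x b where a: "a = (x, b)" "x \<in> S" using Cons.hyps by auto
    have c: "word_class S R [a] \<in> carrier G" "word_class S R w \<in> carrier G"
      "word_class S R [(x, True)] \<in> carrier G"
      using Cons.hyps a by (auto simp: G_def intro: word_class_closed)
    have "P \<otimes>\<^bsub>G\<^esub> word_class S R [a] = word_class S R [a] \<otimes>\<^bsub>G\<^esub> P"
    proof (cases b)
      case True
      then show ?thesis using a gens by simp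
    next
      case False
      then show ?thesis
        using a gens \<open>P \<in> carrier G\<close> c
        by (simp add: word_class_inverse_letter G_def[symmetric] commute_inv)
    qed
    then have "P \<otimes>\<^bsub>G\<^esub> (word_class S R [a] \<otimes>\<^bsub>G\<^esub> word_class S R w)
        = (word_class S R [a] \<otimes>\<^bsub>G\<^esub> word_class S R w) \<otimes>\<^bsub>G\<^esub> P"
      using Cons.IH c \<open>P \<in> carrier G\<close> by (intro commute_mult)
    moreover have "word_class S R [a] \<otimes>\<^bsub>G\<^esub> word_class S R w = word_class S R (a # w)"
      using Cons.hyps word_class_append[of "[a]" S w R] by (simp add: G_def)
    ultimately show ?case by simp
  qed
  then show ?thesis using w by simp
qed

text \<open>The preceding lemma is used twice: generators commute with everything because they commute with
  generators, and then everything commutes with everything.\<close>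

lemma comm_group_presented_group:
  fixes S :: "'x set" and R :: "('x word \<times> 'x word) set"
  defines "G \<equiv> presented_group S R"
  assumes "\<And>x y. \<lbrakk>x \<in> S; y \<in> S\<rbrakk> \<Longrightarrow>
    word_class S R [(x, True)] \<otimes>\<^bsub>G\<^esub> word_class S R [(y, True)]
      = word_class S R [(y, True)] \<otimes>\<^bsub>G\<^esub> word_class S R [(x, True)]"
  shows "comm_group G"
proof -
  have *: "word_class S R [(x, True)] \<otimes>\<^bsub>G\<^esub> P = P \<otimes>\<^bsub>G\<^esub> word_class S R [(x, True)]"
    if "x \<in> S" "P \<in> carrier G" for x P
    using that assms(2)[OF \<open>x \<in> S\<close>] unfolding G_def
    by - (rule commute_presented_group, auto intro: word_class_closed)
  have "P \<otimes>\<^bsub>G\<^esub> Q = Q \<otimes>\<^bsub>G\<^esub> P" if "P \<in> carrier G" "Q \<in> carrier G" for P Q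
    using that *[symmetric] unfolding G_def by - (rule commute_presented_group, auto)
  then show ?thesis
    unfolding G_def by (intro group.group_comm_groupI group_presented_group) auto
qed


section \<open>Groups satisfying the relations of a simplicial set\<close>

text \<open>Edges are \<open>1\<close>-simplices; without this the simplifier turns the dimension into \<open>Suc 0\<close>, which
  no longer matches the facts about edges.\<close>

declare One_nat_def [simp del]

text \<open>A map from the edges of \<open>Y\<close> to a group that satisfies the relations of \<open>\<pi>\<^sub>1(\<int>\<^sub>d, Y)\<close>, that is,
  a homomorphism out of that group given by its values on the generators.  All consequences of the
  relations can then be derived inside an ordinary group instead of on words.\<close>

locale pi1_representation = group G for G (structure) +
  fixes d :: nat and Y :: "'y sset" and E :: "'y \<Rightarrow> 'a"
  assumes E_closed: "u \<in> simplices Y 1 \<Longrightarrow> E u \<in> carrier G"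
    and E_torsion: "u \<in> simplices Y 1 \<Longrightarrow> E u [^] d = \<one>"
    and E_commute: "\<lbrakk>\<sigma> \<in> simplices Y 2; i \<in> {0, 1, 2}; j \<in> {0, 1, 2}\<rbrakk>
      \<Longrightarrow> E (face Y 2 i \<sigma>) \<otimes> E (face Y 2 j \<sigma>) = E (face Y 2 j \<sigma>) \<otimes> E (face Y 2 i \<sigma>)"
    and E_mult: "\<sigma> \<in> simplices Y 2
      \<Longrightarrow> E (face Y 2 2 \<sigma>) \<otimes> E (face Y 2 0 \<sigma>) = E (face Y 2 1 \<sigma>)"

text \<open>The universal representation.  Closure under faces is needed because a relation only acts on
  words whose letters are edges.\<close>

lemma pi1_representation_pi1:
  assumes faces: "\<And>\<sigma> i. \<lbrakk>\<sigma> \<in> simplices Y 2; i \<in> {0, 1, 2}\<rbrakk> \<Longrightarrow> face Y 2 i \<sigma> \<in> simplices Y 1"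
  shows "pi1_representation (pi1 d Y) d Y
    (\<lambda>u. word_class (simplices Y 1) (pi1_relations d Y) [(u, True)])"
proof -
  let ?S = "simplices Y 1" and ?R = "pi1_relations d Y"
  interpret group "pi1 d Y" unfolding pi1_def by (rule group_presented_group)
  let ?E = "\<lambda>u. word_class ?S ?R [(u, True)]"
  have closed: "?E u \<in> carrier (pi1 d Y)" if "u \<in> ?S" for u
    using that by (auto simp: pi1_def intro: word_class_closed)
  show ?thesis
  proof unfold_locales
    fix u assume u: "u \<in> ?S"
    show "?E u \<in> carrier (pi1 d Y)" using u by (rule closed)
    have "word_class ?S ?R (replicate d (u, True)) = word_class ?S ?R []"
      using u by (intro presented_group_relation) (auto simp: pi1_relations_def in_lists_conv_set)
    then show "?E u [^]\<^bsub>pi1 d Y\<^esub> d = \<one>\<^bsub>pi1 d Y\<^esub>"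
      using u by (simp add: word_class_replicate pi1_def one_presented_group)
  next
    fix \<sigma> i j
    assume *: "\<sigma> \<in> simplices Y 2" "i \<in> {0, 1, 2 :: nat}" "j \<in> {0, 1, 2 :: nat}"
    define a b where "a = face Y 2 i \<sigma>" and "b = face Y 2 j \<sigma>"
    have S: "a \<in> ?S" "b \<in> ?S" using * faces by (auto simp: a_def b_def)
    have "word_class ?S ?R [(a, True), (b, True), (a, False), (b, False)] = word_class ?S ?R []"
      using * S unfolding a_def b_def
      by (intro presented_group_relation) (auto simp: pi1_relations_def)
    moreover have "?E a \<otimes>\<^bsub>pi1 d Y\<^esub> ?E b \<otimes>\<^bsub>pi1 d Y\<^esub> inv\<^bsub>pi1 d Y\<^esub> ?E a \<otimes>\<^bsub>pi1 d Y\<^esub> inv\<^bsub>pi1 d Y\<^esub> ?E b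
        = word_class ?S ?R [(a, True), (b, True), (a, False), (b, False)]"
      using S by (simp add: pi1_def word_class_inverse_letter[symmetric] word_class_append)
    ultimately have "?E a \<otimes>\<^bsub>pi1 d Y\<^esub> ?E b \<otimes>\<^bsub>pi1 d Y\<^esub> inv\<^bsub>pi1 d Y\<^esub> ?E a \<otimes>\<^bsub>pi1 d Y\<^esub> inv\<^bsub>pi1 d Y\<^esub> ?E b
        = \<one>\<^bsub>pi1 d Y\<^esub>"
      by (simp add: pi1_def one_presented_group)
    then show "?E (face Y 2 i \<sigma>) \<otimes>\<^bsub>pi1 d Y\<^esub> ?E (face Y 2 j \<sigma>)
        = ?E (face Y 2 j \<sigma>) \<otimes>\<^bsub>pi1 d Y\<^esub> ?E (face Y 2 i \<sigma>)"
      using closed[OF S(1)] closed[OF S(2)] unfolding a_def[symmetric] b_def[symmetric]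
      by (metis inv_closed inv_solve_right' l_one m_closed)
  next
    fix \<sigma> assume *: "\<sigma> \<in> simplices Y 2"
    have "word_class ?S ?R [(face Y 2 2 \<sigma>, True), (face Y 2 0 \<sigma>, True)]
        = word_class ?S ?R [(face Y 2 1 \<sigma>, True)]"
      using * faces by (intro presented_group_relation) (auto simp: pi1_relations_def)
    then show "?E (face Y 2 2 \<sigma>) \<otimes>\<^bsub>pi1 d Y\<^esub> ?E (face Y 2 0 \<sigma>) = ?E (face Y 2 1 \<sigma>)"
      using * faces by (simp add: pi1_def word_class_append)
  qed
qed

section \<open>Representations of a twisted product\<close>

locale twisted_representation =
  X: simplicial_set X + A: group A + pi1_representation G d "twisted_product A X \<gamma>" E
  for X :: "'x sset" and A :: "('g, 'm) monoid_scheme" and \<gamma> :: "'x \<Rightarrow> 'g"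
    and G :: "('h, 'n) monoid_scheme" (structure) and d :: nat
    and E :: "'g list \<times> 'x \<Rightarrow> 'h" +
  assumes \<gamma>_closed: "\<sigma> \<in> simplices X 2 \<Longrightarrow> \<gamma> \<sigma> \<in> carrier A"
    and \<gamma>_normalized: "\<sigma> \<in> degenerate X 2 \<Longrightarrow> \<gamma> \<sigma> = \<one>\<^bsub>A\<^esub>"

lemma twisted_product_edges:
  "([a], u) \<in> simplices (twisted_product A X \<gamma>) 1 \<longleftrightarrow> a \<in> carrier A \<and> u \<in> simplices X 1"
  by (simp add: twisted_product_def nerve_def)

lemma twisted_product_triangles:
  "([a, b], \<sigma>) \<in> simplices (twisted_product A X \<gamma>) 2
    \<longleftrightarrow> a \<in> carrier A \<and> b \<in> carrier A \<and> \<sigma> \<in> simplices X 2"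
  by (simp add: twisted_product_def nerve_def)

lemma twisted_product_face_2_1:
  "face (twisted_product A X \<gamma>) 2 1 ([a, b], \<sigma>) = ([a \<otimes>\<^bsub>A\<^esub> b], face X 2 1 \<sigma>)"
  by (simp add: twisted_product_def nerve_def)

lemma twisted_product_face_2_2:
  "face (twisted_product A X \<gamma>) 2 2 ([a, b], \<sigma>) = ([a], face X 2 2 \<sigma>)"
  by (simp add: twisted_product_def nerve_def)

context twisted_representation
begin

text \<open>The edges over a degenerate edge form a copy of \<open>A\<close> over the vertex.\<close>

definition fiber :: "'x \<Rightarrow> 'g \<Rightarrow> 'h" where
  "fiber v a = E ([a], degen X 0 0 v)"

definition base :: "'x \<Rightarrow> 'h" where
  "base u = E ([\<one>\<^bsub>A\<^esub>], u)"

lemma edge_closed: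
  "\<lbrakk>a \<in> carrier A; u \<in> simplices X 1\<rbrakk> \<Longrightarrow> E ([a], u) \<in> carrier G"
  by (simp add: E_closed twisted_product_edges)

lemma vertex_degen: "v \<in> simplices X 0 \<Longrightarrow> degen X 0 0 v \<in> simplices X 1"
  using X.degen_closed[of v 0 0] by simp

lemma edge_vertex: "\<lbrakk>u \<in> simplices X 1; i \<le> 1\<rbrakk> \<Longrightarrow> face X 1 i u \<in> simplices X 0"
  using X.face_closed[of u 1 i] by simp

lemma fiber_closed:
  "\<lbrakk>v \<in> simplices X 0; a \<in> carrier A\<rbrakk> \<Longrightarrow> fiber v a \<in> carrier G"
  by (simp add: fiber_def edge_closed vertex_degen)

lemma base_closed: "u \<in> simplices X 1 \<Longrightarrow> base u \<in> carrier G"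
  by (simp add: base_def edge_closed)

lemma E_triangle:
  assumes "\<sigma> \<in> simplices X 2" "a \<in> carrier A" "b \<in> carrier A"
  shows "E ([a], face X 2 2 \<sigma>) \<otimes> E ([\<gamma> \<sigma> \<otimes>\<^bsub>A\<^esub> b], face X 2 0 \<sigma>) = E ([a \<otimes>\<^bsub>A\<^esub> b], face X 2 1 \<sigma>)"
    and "E ([a], face X 2 2 \<sigma>) \<otimes> E ([\<gamma> \<sigma> \<otimes>\<^bsub>A\<^esub> b], face X 2 0 \<sigma>)
      = E ([\<gamma> \<sigma> \<otimes>\<^bsub>A\<^esub> b], face X 2 0 \<sigma>) \<otimes> E ([a], face X 2 2 \<sigma>)"
  using E_mult[of "([a, b], \<sigma>)"] E_commute[of "([a, b], \<sigma>)" 2 0] assms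
  by (simp_all add: twisted_product_triangles twisted_product_face_2_0
      twisted_product_face_2_1[simplified] twisted_product_face_2_2)

lemma degen_triangle:
  assumes "u \<in> simplices X 1" "j \<le> 1"
  shows "degen X 1 j u \<in> simplices X 2" "\<gamma> (degen X 1 j u) = \<one>\<^bsub>A\<^esub>"
proof -
  show "degen X 1 j u \<in> simplices X 2"
    using X.degen_closed[of u 1 j] assms by (simp add: numeral_2_eq_2)
  have "degen X 1 j u \<in> degenerate X 2"
    using assms unfolding degenerate_def
    by (intro CollectI exI[of _ u] exI[of _ j] exI[of _ 1]) (simp add: numeral_2_eq_2)
  then show "\<gamma> (degen X 1 j u) = \<one>\<^bsub>A\<^esub>" by (rule \<gamma>_normalized)
qed

text \<open>The triangle \<open>s\<^sub>0 u\<close> is degenerate at the source of \<open>u\<close>: it splits the fibre coordinate off on the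
  left.  The triangle \<open>s\<^sub>1 u\<close>, used afterwards, is degenerate at the target and splits it off on the
  right.\<close>

lemma fiber_source:
  assumes "u \<in> simplices X 1" "a \<in> carrier A" "b \<in> carrier A"
  shows "E ([a \<otimes>\<^bsub>A\<^esub> b], u) = fiber (face X 1 1 u) a \<otimes> E ([b], u)"
    and "fiber (face X 1 1 u) a \<otimes> E ([b], u) = E ([b], u) \<otimes> fiber (face X 1 1 u) a"
proof -
  have "face X 2 0 (degen X 1 0 u) = u" "face X 2 1 (degen X 1 0 u) = u"
    using X.face_degen_id[of u 1 0 0] X.face_degen_id[of u 1 0 1] assms
    by (simp_all add: numeral_2_eq_2)
  moreover have "face X 2 2 (degen X 1 0 u) = degen X 0 0 (face X 1 1 u)"
    using X.face_degen_greater[of u 1 0 2] assms by (simp flip: One_nat_def)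
  ultimately show "E ([a \<otimes>\<^bsub>A\<^esub> b], u) = fiber (face X 1 1 u) a \<otimes> E ([b], u)"
    and "fiber (face X 1 1 u) a \<otimes> E ([b], u) = E ([b], u) \<otimes> fiber (face X 1 1 u) a"
    using E_triangle[of "degen X 1 0 u" a b] degen_triangle[of u 0] assms
    by (simp_all add: fiber_def)
qed

lemma fiber_target:
  assumes "u \<in> simplices X 1" "a \<in> carrier A" "b \<in> carrier A"
  shows "E ([a \<otimes>\<^bsub>A\<^esub> b], u) = E ([a], u) \<otimes> fiber (face X 1 0 u) b"
proof -
  have "face X 2 1 (degen X 1 1 u) = u" "face X 2 2 (degen X 1 1 u) = u"
    using X.face_degen_id[of u 1 1 1] X.face_degen_id[of u 1 1 2] assms
    by (simp_all add: numeral_2_eq_2)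
  moreover have "face X 2 0 (degen X 1 1 u) = degen X 0 0 (face X 1 0 u)"
    using X.face_degen_less[of u 1 0 1] assms by (simp add: numeral_2_eq_2)
  ultimately show ?thesis
    using E_triangle[of "degen X 1 1 u" a b] degen_triangle[of u 1] assms
    by (simp add: fiber_def)
qed

text \<open>Both degenerate triangles factor the generator of \<open>([a], u)\<close> through the generator \<open>base u\<close>, and
  the left factor can be moved to the right.\<close>

lemma fiber_source_eq_target:
  assumes "u \<in> simplices X 1" "a \<in> carrier A"
  shows "fiber (face X 1 1 u) a = fiber (face X 1 0 u) a"
proof -
  have "base u \<otimes> fiber (face X 1 1 u) a = E ([a], u)"
    using fiber_source[of u a "\<one>\<^bsub>A\<^esub>"] assms by (simp add: base_def)
  also have "\<dots> = base u \<otimes> fiber (face X 1 0 u) a"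
    using fiber_target[of u "\<one>\<^bsub>A\<^esub>" a] assms by (simp add: base_def)
  finally show ?thesis
    using assms by (simp add: base_closed fiber_closed edge_vertex)
qed

text \<open>The case of a degenerate edge \<open>u\<close> in the splitting at the source.\<close>

lemma fiber_mult:
  assumes "v \<in> simplices X 0" "a \<in> carrier A" "b \<in> carrier A"
  shows "fiber v a \<otimes> fiber v b = fiber v (a \<otimes>\<^bsub>A\<^esub> b)"
  using fiber_source(1)[of "degen X 0 0 v" a b] X.face_degen_id[of v 0 0 1] assms
  by (simp add: fiber_def vertex_degen)

lemma fiber_torsion:
  "\<lbrakk>v \<in> simplices X 0; a \<in> carrier A\<rbrakk> \<Longrightarrow> fiber v a [^] d = \<one>"
  by (simp add: fiber_def E_torsion twisted_product_edges vertex_degen)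

lemma edge_eq_base_fiber:
  assumes "u \<in> simplices X 1" "a \<in> carrier A"
  shows "E ([a], u) = base u \<otimes> fiber (face X 1 0 u) a"
  using fiber_target[of u "\<one>\<^bsub>A\<^esub>" a] assms by (simp add: base_def)

lemma base_degen: "v \<in> simplices X 0 \<Longrightarrow> base (degen X 0 0 v) = \<one>"
  using fiber_mult[of v "\<one>\<^bsub>A\<^esub>" "\<one>\<^bsub>A\<^esub>"] fiber_closed[of v "\<one>\<^bsub>A\<^esub>"]
  by (simp add: base_def fiber_def[symmetric])

text \<open>The relations of \<open>\<sigma>\<close> reduced to fibre coordinate \<open>\<one>\<close>.  For the product, the twist \<open>\<gamma> \<sigma>\<close> comes out as a
  fibre element; for the commutation, it is compensated by the choice \<open>b = inv (\<gamma> \<sigma>)\<close> of the second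
  coordinate.\<close>

lemma base_triangle:
  assumes "\<sigma> \<in> simplices X 2"
  shows "base (face X 2 2 \<sigma>) \<otimes> base (face X 2 0 \<sigma>)
      \<otimes> fiber (face X 1 0 (face X 2 0 \<sigma>)) (\<gamma> \<sigma>) = base (face X 2 1 \<sigma>)"
    and "base (face X 2 2 \<sigma>) \<otimes> base (face X 2 0 \<sigma>) = base (face X 2 0 \<sigma>) \<otimes> base (face X 2 2 \<sigma>)"
proof -
  have f: "face X 2 i \<sigma> \<in> simplices X 1" if "i \<le> 2" for i
    using X.face_closed[of \<sigma> 2 i] assms that by (simp add: One_nat_def)
  note g = \<gamma>_closed[OF assms]
  show "base (face X 2 2 \<sigma>) \<otimes> base (face X 2 0 \<sigma>)
      \<otimes> fiber (face X 1 0 (face X 2 0 \<sigma>)) (\<gamma> \<sigma>) = base (face X 2 1 \<sigma>)"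
    using E_triangle(1)[OF assms, of "\<one>\<^bsub>A\<^esub>" "\<one>\<^bsub>A\<^esub>"] f g
    by (simp add: base_def[symmetric] edge_eq_base_fiber m_assoc base_closed fiber_closed edge_vertex)
  show "base (face X 2 2 \<sigma>) \<otimes> base (face X 2 0 \<sigma>) = base (face X 2 0 \<sigma>) \<otimes> base (face X 2 2 \<sigma>)"
    using E_triangle(2)[OF assms, of "\<one>\<^bsub>A\<^esub>" "inv\<^bsub>A\<^esub> \<gamma> \<sigma>"] g by (simp add: base_def)
qed

end


section \<open>The torus\<close>

lemma (in group) odd_torsion_involution:
  assumes "c \<in> carrier G" "c \<otimes> c = \<one>" "c [^] (d :: nat) = \<one>" "odd d"
  shows "c = \<one>"
proof -
  obtain k where "d = 2 * k + 1" using \<open>odd d\<close> by (rule oddE)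
  then have "c [^] d = (c [^] (2 :: nat)) [^] k \<otimes> c"
    using assms(1) by (simp add: nat_pow_pow nat_pow_mult[symmetric] One_nat_def)
  also have "\<dots> = c" using assms(1,2) by (simp add: numeral_2_eq_2)
  finally show ?thesis using assms(3) by simp
qed

lemma (in group) commuting_factors:
  assumes carr: "P \<in> carrier G" "Q \<in> carrier G" "i \<in> carrier G" "j \<in> carrier G"
    and comm: "i \<otimes> Q = Q \<otimes> i" "j \<otimes> P = P \<otimes> j" "i \<otimes> j = j \<otimes> i"
  shows "(P \<otimes> i) \<otimes> (Q \<otimes> j) = (P \<otimes> Q) \<otimes> (i \<otimes> j)"
    and "(P \<otimes> i) \<otimes> (Q \<otimes> j) = (Q \<otimes> j) \<otimes> (P \<otimes> i) \<Longrightarrow> P \<otimes> Q = Q \<otimes> P"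
proof -
  show *: "(P \<otimes> i) \<otimes> (Q \<otimes> j) = (P \<otimes> Q) \<otimes> (i \<otimes> j)"
    using assms by (metis m_assoc m_closed)
  have "(Q \<otimes> j) \<otimes> (P \<otimes> i) = (Q \<otimes> P) \<otimes> (i \<otimes> j)"
    using assms by (metis m_assoc m_closed)
  then show "P \<otimes> Q = Q \<otimes> P" if "(P \<otimes> i) \<otimes> (Q \<otimes> j) = (Q \<otimes> j) \<otimes> (P \<otimes> i)"
    using that * carr by simp
qed

text \<open>Here \<open>p\<close> and \<open>q\<close> can be moved past \<open>x\<close> and \<open>y\<close>, so every hypothesis compares one of \<open>x y\<close>, \<open>y x\<close> times
  one of \<open>p q\<close>, \<open>q p\<close>.  Exchanging both factors has no effect by \<open>opp\<close>, and exchanging the first one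
  alone costs \<open>c\<close> by \<open>rel\<close>.  Together these give \<open>q p = p q c\<close> and \<open>p q = q p c\<close>, so \<open>c\<close> is an
  involution.\<close>

lemma (in group) K33_core:
  assumes carr: "x \<in> carrier G" "y \<in> carrier G" "p \<in> carrier G" "q \<in> carrier G" "c \<in> carrier G"
    and comm: "p \<otimes> x = x \<otimes> p" "p \<otimes> y = y \<otimes> p" "q \<otimes> x = x \<otimes> q" "q \<otimes> y = y \<otimes> q"
    and opp: "(p \<otimes> x) \<otimes> (y \<otimes> q) = (y \<otimes> q) \<otimes> (p \<otimes> x)" "(p \<otimes> y) \<otimes> (x \<otimes> q) = (x \<otimes> q) \<otimes> (p \<otimes> y)"
    and rel: "(p \<otimes> x) \<otimes> (y \<otimes> q) = (p \<otimes> y) \<otimes> (x \<otimes> q) \<otimes> c"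
    and c: "c [^] (d :: nat) = \<one>" "odd d"
  shows "x \<otimes> y = y \<otimes> x" "p \<otimes> q = q \<otimes> p"
proof -
  have lcomm: "w \<otimes> (z \<otimes> r) = z \<otimes> (w \<otimes> r)"
    if "w \<otimes> z = z \<otimes> w" "w \<in> carrier G" "z \<in> carrier G" "r \<in> carrier G" for w z r
    using that by (metis m_assoc)
  note normalize = m_assoc comm lcomm[OF comm(1)] lcomm[OF comm(2)] lcomm[OF comm(3)] lcomm[OF comm(4)]
  define a b m n where "a = x \<otimes> y" and "b = y \<otimes> x" and "m = p \<otimes> q" and "n = q \<otimes> p"
  have carr': "a \<in> carrier G" "b \<in> carrier G" "m \<in> carrier G" "n \<in> carrier G"
    using carr by (simp_all add: a_def b_def m_def n_def)
  have 1: "a \<otimes> m = b \<otimes> n" using opp(1) carr by (simp add: normalize a_def b_def m_def n_def)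
  have 2: "b \<otimes> m = a \<otimes> n" using opp(2) carr by (simp add: normalize a_def b_def m_def n_def)
  have 3: "a \<otimes> m = b \<otimes> (m \<otimes> c)" using rel carr by (simp add: normalize a_def b_def m_def n_def)
  from 1 3 have n: "n = m \<otimes> c" using carr carr' by simp
  have "b \<otimes> m \<otimes> \<one> = a \<otimes> m \<otimes> c" using 2 n carr carr' by (simp add: m_assoc)
  also have "\<dots> = b \<otimes> m \<otimes> (c \<otimes> c)" using 3 carr carr' by (simp add: m_assoc)
  finally have "c \<otimes> c = \<one>" using carr carr' by simp
  then have "c = \<one>" using odd_torsion_involution carr(5) c by blast
  then have "m = n" "a \<otimes> m = b \<otimes> m" using n 3 carr carr' by simp_all
  then show "x \<otimes> y = y \<otimes> x" "p \<otimes> q = q \<otimes> p"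
    using carr' by (simp_all add: a_def b_def m_def n_def)
qed

lemma K33_torus_edges:
  assumes "is_K33_torus X v e t"
  shows "simplices X 1 = range e \<union> degen X 0 0 ` simplices X 0"
proof -
  interpret simplicial_set X using assms by (simp add: is_K33_torus_def)
  have "range e = simplices X 1 - degenerate X 1"
    using assms by (simp add: is_K33_torus_def bij_betw_def nondegenerate_def)
  moreover have "degenerate X 1 = degen X 0 0 ` simplices X 0"
    by (auto simp: degenerate_def)
  moreover have "degenerate X 1 \<subseteq> simplices X 1"
    using degen_closed[of _ 0 0] by (auto simp: degenerate_def)
  ultimately show ?thesis by blast
qed

lemma K33_torus_vertices:
  assumes "is_K33_torus X v e t"
  shows "simplices X 0 = range v"
  using assms by (simp add: is_K33_torus_def bij_betw_def nondegenerate_def degenerate_def)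

lemma K33_torus_triangles:
  assumes "is_K33_torus X v e t"
  shows "t s \<in> simplices X 2"
  using assms by (auto simp: is_K33_torus_def bij_betw_def nondegenerate_def)

context twisted_representation
begin

context
  fixes v :: "vertex \<Rightarrow> 'x" and e :: "edge \<Rightarrow> 'x" and t :: "triangle \<Rightarrow> 'x"
  assumes K33: "is_K33_torus X v e t"
begin

abbreviation J :: "'g \<Rightarrow> 'h" where "J \<equiv> fiber (v vA)"

lemma e_edge: "e a \<in> simplices X 1"
  using K33_torus_edges[OF K33] by blast

lemma v_vertex: "v w \<in> simplices X 0"
  using K33_torus_vertices[OF K33] by blast

text \<open>The torus is connected: \<open>z\<^sub>1\<close> joins \<open>A\<close> to \<open>B\<close> and \<open>z\<^sub>2\<close> joins \<open>A\<close> to \<open>C\<close>.\<close>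

lemma fiber_vertex:
  assumes "w \<in> simplices X 0" "a \<in> carrier A"
  shows "fiber w a = J a"
proof -
  have *: "fiber (v (source u)) a = fiber (v (target u)) a" for u
    using fiber_source_eq_target[of "e u" a] e_edge assms(2) K33 by (simp add: is_K33_torus_def)
  obtain w' where "w = v w'" using assms(1) K33_torus_vertices[OF K33] by blast
  then show ?thesis using *[of ez1] *[of ez2] by (cases w') simp_all
qed

lemma J_commute:
  assumes "u \<in> simplices X 1" "a \<in> carrier A" "b \<in> carrier A"
  shows "J a \<otimes> E ([b], u) = E ([b], u) \<otimes> J a"
  using fiber_source(2)[OF assms] assms by (simp add: fiber_vertex edge_vertex)

lemma J_closed: "a \<in> carrier A \<Longrightarrow> J a \<in> carrier G"
  by (simp add: fiber_closed v_vertex)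

lemma edge_eq_base_J:
  assumes "u \<in> simplices X 1" "a \<in> carrier A"
  shows "E ([a], u) = base u \<otimes> J a"
  using assms by (simp add: edge_eq_base_fiber fiber_vertex edge_vertex)

lemma K33_triangle:
  assumes "boundary s = (f, g, h)"
  shows "base (e h) = base (e f) \<otimes> base (e g) \<otimes> J (\<gamma> (t s))"
    and "base (e f) \<otimes> base (e g) = base (e g) \<otimes> base (e f)"
proof -
  have s: "t s \<in> simplices X 2" using K33_torus_triangles[OF K33] .
  have f: "face X 2 2 (t s) = e f" "face X 2 0 (t s) = e g" "face X 2 1 (t s) = e h"
    using K33 assms unfolding is_K33_torus_def by (metis (mono_tags, lifting) case_prod_conv prod.inject)+
  show "base (e h) = base (e f) \<otimes> base (e g) \<otimes> J (\<gamma> (t s))"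
    using base_triangle(1)[OF s] fiber_vertex[OF edge_vertex[OF e_edge] \<gamma>_closed[OF s]]
    by (simp add: f)
  show "base (e f) \<otimes> base (e g) = base (e g) \<otimes> base (e f)"
    using base_triangle(2)[OF s] by (simp add: f)
qed

text \<open>All edges are products of the four edges \<open>z\<^sub>1, x, y, z\<^sub>3\<close> and fibre elements: \<open>\<sigma>\<^sub>1, \<sigma>\<^sub>3, \<sigma>\<^sub>4, \<sigma>\<^sub>6\<close>
  produce \<open>t\<^sub>1, t\<^sub>2, s\<^sub>1, s\<^sub>2\<close>, and \<open>\<sigma>\<^sub>2\<close> produces \<open>z\<^sub>2\<close>.\<close>

lemma commute_edges:
  assumes w: "w \<in> carrier G"
    and J: "\<And>a. a \<in> carrier A \<Longrightarrow> w \<otimes> J a = J a \<otimes> w"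
    and gens: "\<And>g. g \<in> {ez1, ex, ey, ez3} \<Longrightarrow> w \<otimes> base (e g) = base (e g) \<otimes> w"
    and u: "u \<in> simplices X 1" and a: "a \<in> carrier A"
  shows "w \<otimes> E ([a], u) = E ([a], u) \<otimes> w"
proof -
  have b: "base (e g) \<in> carrier G" for g by (simp add: base_closed e_edge)
  have product: "w \<otimes> base (e h) = base (e h) \<otimes> w"
    if "boundary s = (f, g, h)" "w \<otimes> base (e f) = base (e f) \<otimes> w" "w \<otimes> base (e g) = base (e g) \<otimes> w"
    for s f g h
    using that(2,3) w J \<gamma>_closed[OF K33_torus_triangles[OF K33], of s] b
    unfolding K33_triangle(1)[OF that(1)]
    by (intro commute_mult m_closed) (auto intro: J_closed)
  have t1: "w \<otimes> base (e et1) = base (e et1) \<otimes> w"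
    by (rule product[of sigma1 ez1 ex, OF _ gens gens]) simp_all
  have t2: "w \<otimes> base (e et2) = base (e et2) \<otimes> w"
    by (rule product[of sigma3 ey ez3, OF _ gens gens]) simp_all
  have s1: "w \<otimes> base (e es1) = base (e es1) \<otimes> w"
    by (rule product[of sigma4 ez1 ey, OF _ gens gens]) simp_all
  have s2: "w \<otimes> base (e es2) = base (e es2) \<otimes> w"
    by (rule product[of sigma6 ex ez3, OF _ gens gens]) simp_all
  have z2: "w \<otimes> base (e ez2) = base (e ez2) \<otimes> w"
    by (rule product[of sigma2 et1 et2, OF _ t1 t2]) simp
  have "w \<otimes> base (e g) = base (e g) \<otimes> w" for g
    using gens t1 t2 s1 s2 z2 by (cases g) auto
  then have "w \<otimes> base u = base u \<otimes> w"
    using u w by (auto simp: K33_torus_edges[OF K33] base_degen)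
  then show ?thesis
    using u a w J by (simp add: edge_eq_base_J commute_mult base_closed J_closed)
qed

text \<open>A triangle \<open>s''\<close> whose first two sides are the long sides of triangles \<open>s\<close> and \<open>s'\<close> is a way to
  compute the edge \<open>k\<close> from the short sides, up to a central fibre element.  The edge \<open>z\<^sub>2\<close> is
  reached in two such ways.\<close>

lemma K33_composite_triangle:
  assumes s: "boundary s = (f, g, h)" and s': "boundary s' = (f', g', h')"
    and s'': "boundary s'' = (h, h', k)" and A: "comm_group A"
  obtains a where "a \<in> carrier A"
    "base (e k) = (base (e f) \<otimes> base (e g)) \<otimes> (base (e f') \<otimes> base (e g')) \<otimes> J a"
    "(base (e f) \<otimes> base (e g)) \<otimes> (base (e f') \<otimes> base (e g'))
      = (base (e f') \<otimes> base (e g')) \<otimes> (base (e f) \<otimes> base (e g))"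
proof -
  interpret A: comm_group A by (rule A)
  define P Q where "P = base (e f) \<otimes> base (e g)" and "Q = base (e f') \<otimes> base (e g')"
  define c where "c s = \<gamma> (t s)" for s
  have c: "c s \<in> carrier A" for s
    unfolding c_def by (intro \<gamma>_closed K33_torus_triangles[OF K33])
  have b: "base (e h) \<in> carrier G" for h by (simp add: base_closed e_edge)
  then have PQ: "P \<in> carrier G" "Q \<in> carrier G" by (simp_all add: P_def Q_def)
  have Jb: "J a \<otimes> base (e h) = base (e h) \<otimes> J a" if "a \<in> carrier A" for a h
    using J_commute[OF e_edge that, of "\<one>\<^bsub>A\<^esub>"] by (simp add: base_def)
  have JP: "J (c r) \<otimes> P = P \<otimes> J (c r)" and JQ: "J (c r) \<otimes> Q = Q \<otimes> J (c r)" for r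
    unfolding P_def Q_def by (simp_all add: commute_mult Jb c b J_closed)
  have J_mult: "J a \<otimes> J b = J (a \<otimes>\<^bsub>A\<^esub> b)" if "a \<in> carrier A" "b \<in> carrier A" for a b
    using that by (intro fiber_mult v_vertex)
  have JJ: "J (c s) \<otimes> J (c s') = J (c s') \<otimes> J (c s)"
    by (simp add: J_mult c A.m_comm)
  have h: "base (e h) = P \<otimes> J (c s)" "base (e h') = Q \<otimes> J (c s')"
    using K33_triangle(1)[OF s] K33_triangle(1)[OF s'] by (simp_all add: P_def Q_def c_def)
  note prod = commuting_factors[OF PQ J_closed[OF c] J_closed[OF c] JQ JP JJ]
  show ?thesis
  proof (rule that)
    show "c s \<otimes>\<^bsub>A\<^esub> c s' \<otimes>\<^bsub>A\<^esub> c s'' \<in> carrier A" using c by simp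
    show "base (e k) = (base (e f) \<otimes> base (e g)) \<otimes> (base (e f') \<otimes> base (e g'))
        \<otimes> J (c s \<otimes>\<^bsub>A\<^esub> c s' \<otimes>\<^bsub>A\<^esub> c s'')"
      using K33_triangle(1)[OF s''] prod(1) c PQ
      by (simp add: h c_def[symmetric] P_def[symmetric] Q_def[symmetric] m_assoc J_closed J_mult)
    show "(base (e f) \<otimes> base (e g)) \<otimes> (base (e f') \<otimes> base (e g'))
        = (base (e f') \<otimes> base (e g')) \<otimes> (base (e f) \<otimes> base (e g))"
      using K33_triangle(2)[OF s''] prod(2) by (simp add: h P_def Q_def)
  qed
qed

lemma edges_commute:
  assumes A: "comm_group A" and "odd d"
    and u: "u \<in> simplices X 1" "a \<in> carrier A" and u': "u' \<in> simplices X 1" "a' \<in> carrier A"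
  shows "E ([a], u) \<otimes> E ([a'], u') = E ([a'], u') \<otimes> E ([a], u)"
proof -
  define x y p q where "x = base (e ex)" and "y = base (e ey)"
    and "p = base (e ez1)" and "q = base (e ez3)"
  note defs = x_def[symmetric] y_def[symmetric] p_def[symmetric] q_def[symmetric]
  have carr: "x \<in> carrier G" "y \<in> carrier G" "p \<in> carrier G" "q \<in> carrier G"
    by (simp_all add: x_def y_def p_def q_def base_closed e_edge)
  have comm: "p \<otimes> x = x \<otimes> p" "p \<otimes> y = y \<otimes> p" "q \<otimes> x = x \<otimes> q" "q \<otimes> y = y \<otimes> q"
    using K33_triangle(2)[of sigma1] K33_triangle(2)[of sigma4] K33_triangle(2)[of sigma6]
      K33_triangle(2)[of sigma3] by (simp_all add: defs)
  obtain a1 where a1: "a1 \<in> carrier A" "base (e ez2) = (p \<otimes> x) \<otimes> (y \<otimes> q) \<otimes> J a1"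
    "(p \<otimes> x) \<otimes> (y \<otimes> q) = (y \<otimes> q) \<otimes> (p \<otimes> x)"
    using K33_composite_triangle[OF _ _ _ A, of sigma1 ez1 ex et1 sigma3 ey ez3 et2 sigma2 ez2]
    by (auto simp: defs)
  obtain a2 where a2: "a2 \<in> carrier A" "base (e ez2) = (p \<otimes> y) \<otimes> (x \<otimes> q) \<otimes> J a2"
    "(p \<otimes> y) \<otimes> (x \<otimes> q) = (x \<otimes> q) \<otimes> (p \<otimes> y)"
    using K33_composite_triangle[OF _ _ _ A, of sigma4 ez1 ey es1 sigma6 ex ez3 es2 sigma5 ez2]
    by (auto simp: defs)
  \<comment> \<open>Comparing the two expressions for \<open>z\<^sub>2\<close>, the defect is a single value of \<open>J\<close>, hence of exponent \<open>d\<close>.\<close>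
  define b where "b = a2 \<otimes>\<^bsub>A\<^esub> inv\<^bsub>A\<^esub> a1"
  have b: "b \<in> carrier A" "b \<otimes>\<^bsub>A\<^esub> a1 = a2" using a1(1) a2(1) by (simp_all add: b_def A.m_assoc)
  have "(p \<otimes> x) \<otimes> (y \<otimes> q) \<otimes> J a1 = (p \<otimes> y) \<otimes> (x \<otimes> q) \<otimes> (J b \<otimes> J a1)"
    using a1(2) a2(2) b a1(1) by (simp add: fiber_mult v_vertex)
  also have "\<dots> = (p \<otimes> y) \<otimes> (x \<otimes> q) \<otimes> J b \<otimes> J a1"
    using carr b(1) a1(1) by (simp add: m_assoc J_closed)
  finally have rel: "(p \<otimes> x) \<otimes> (y \<otimes> q) = (p \<otimes> y) \<otimes> (x \<otimes> q) \<otimes> J b"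
    using carr b(1) a1(1) by (simp add: J_closed)
  note xy_pq = K33_core[OF carr J_closed[OF b(1)] comm a1(3) a2(3) rel
      fiber_torsion[OF v_vertex b(1)] \<open>odd d\<close>]
  have gens: "base (e g) \<otimes> base (e g') = base (e g') \<otimes> base (e g)"
    if "g \<in> {ez1, ex, ey, ez3}" "g' \<in> {ez1, ex, ey, ez3}" for g g'
    using that comm xy_pq by (auto simp: defs)
  have J: "E ([a], u) \<otimes> J b = J b \<otimes> E ([a], u)"
    if "u \<in> simplices X 1" "a \<in> carrier A" "b \<in> carrier A" for a b u
    using J_commute that by simp
  have "base (e g) \<otimes> E ([a], u) = E ([a], u) \<otimes> base (e g)" if "g \<in> {ez1, ex, ey, ez3}" for g
    using that u by (intro commute_edges gens base_closed e_edge) (simp_all add: J base_def e_edge)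
  then show ?thesis
    using u u' by (intro commute_edges) (simp_all add: J edge_closed)
qed

end

end

theorem proposition3p25:
  fixes d :: nat
    and X :: "'a sset" and v :: "vertex \<Rightarrow> 'a" and e :: "edge \<Rightarrow> 'a" and t :: "triangle \<Rightarrow> 'a"
    and \<gamma> :: "'a \<Rightarrow> int"
  assumes "d > 1" and "odd d"
    and "is_K33_torus X v e t"
    and "normalized_2_cocycle (integer_mod_group d) X \<gamma>"
  shows "comm_group (pi1 d (twisted_product (integer_mod_group d) X \<gamma>))"
proof -
  let ?A = "integer_mod_group d"
  let ?Y = "twisted_product ?A X \<gamma>"
  let ?E = "\<lambda>u. word_class (simplices ?Y 1) (pi1_relations d ?Y) [(u, True)]"
  interpret X: simplicial_set X using assms(3) by (simp add: is_K33_torus_def)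
  interpret A: group ?A by (rule group_integer_mod_group)
  have A: "comm_group ?A"
    by (rule A.group_comm_groupI) (simp add: add.commute)
  have \<gamma>: "\<gamma> \<sigma> \<in> carrier ?A" if "\<sigma> \<in> simplices X 2" for \<sigma>
    using assms(4) that by (auto simp: normalized_2_cocycle_def)
  have faces: "face ?Y 2 i \<sigma> \<in> simplices ?Y 1" if "\<sigma> \<in> simplices ?Y 2" "i \<in> {0, 1, 2}" for \<sigma> i
  proof -
    obtain a b \<tau> where \<sigma>: "\<sigma> = ([a, b], \<tau>)"
      using \<open>\<sigma> \<in> simplices ?Y 2\<close>
      by (auto simp: twisted_product_def nerve_def numeral_2_eq_2 length_Suc_conv)
    have *: "a \<in> carrier ?A" "b \<in> carrier ?A" "\<tau> \<in> simplices X 2"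
      using \<open>\<sigma> \<in> simplices ?Y 2\<close> unfolding \<sigma> twisted_product_triangles by auto
    have "face X 2 i \<tau> \<in> simplices X 1"
      using X.face_closed[of \<tau> 2 i] * \<open>i \<in> {0, 1, 2}\<close> by (auto simp: One_nat_def)
    then show ?thesis
      using \<open>i \<in> {0, 1, 2}\<close> A.m_closed[OF \<gamma>[OF *(3)] *(2)] A.m_closed[OF *(1,2)] *
      by (auto simp: \<sigma> twisted_product_face_2_0 twisted_product_face_2_1 twisted_product_face_2_2
          twisted_product_edges simp del: mult_integer_mod_group)
  qed
  interpret pi1_representation "pi1 d ?Y" d ?Y ?E
    by (rule pi1_representation_pi1[OF faces])
  interpret twisted_representation X ?A \<gamma> "pi1 d ?Y" d ?E
    using assms(4) \<gamma> by unfold_locales (auto simp: normalized_2_cocycle_def)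
  show ?thesis
    unfolding pi1_def
  proof (rule comm_group_presented_group, fold pi1_def)
    fix u u' assume "u \<in> simplices ?Y 1" "u' \<in> simplices ?Y 1"
    moreover have "\<exists>a w. u = ([a], w) \<and> a \<in> carrier ?A \<and> w \<in> simplices X 1"
      if "u \<in> simplices ?Y 1" for u
      using that by (auto simp: twisted_product_def nerve_def One_nat_def length_Suc_conv)
    ultimately obtain a w a' w' where "u = ([a], w)" "a \<in> carrier ?A" "w \<in> simplices X 1"
      "u' = ([a'], w')" "a' \<in> carrier ?A" "w' \<in> simplices X 1"
      by metis
    then show "?E u \<otimes>\<^bsub>pi1 d ?Y\<^esub> ?E u' = ?E u' \<otimes>\<^bsub>pi1 d ?Y\<^esub> ?E u"
      using edges_commute[OF assms(3) A \<open>odd d\<close>] by simp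
  qed
qed

end
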